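(* Let $Q$ be the quiver on vertices $\{1,2,3,4,5\}$ with arrows $1\to2$, $1\to5$, $3\to1$, $4\to1$, $4\to5$, $5\to2$, $5\to3$, two arrows $2\to3$ and two arrows $3\to4$, and start from the seed $(Q,(x_1,\dots,x_5))$ with $x_1,\dots,x_5$ indeterminates. Suppose a finite sequence of mutations is applied in which each mutation is at a toric vertex of the current quiver, and suppose the final quiver is isomorphic (as a directed graph) to $Q$ or to $Q$ with all arrows reversed. Then there exist $k,m\in\mathbb{Z}_{\ge0}$, $t\in\{1,2\}$ and $w\in\{0,1\}$ such that the final cluster agrees, up to a permutation of its entries, with the cluster obtained by applying the $\rho$-mutation sequence $\rho_t^k(\rho_3\rho_1)^m\rho_3^{w}$ to the initial seed.
   Context: A vertex of a quiver is toric if it has in-degree 2 and out-degree 2 (counting arrows with multiplicity). A seed is a pair (quiver on $\{1,\dots,5\}$ without loops or 2-cycles, ordered cluster $(y_1,\dots,y_5)$). Mutation $\mu_i$: for each 2-path $j\to i\to k$ add an arrow $j\to k$; reverse arrows at $i$; delete 2-cycles; replace $y_i$ by $\big(\prod_{i\to j}y_j^{a_{i\to j}}+\prod_{j\to i}y_j^{a_{j\to i}}\big)/y_i$ ($a_{i\to j}$ = number of arrows $i\to j$ before mutation). For a permutation $\sigma$ in cycle notation, applying $\sigma$ relabels vertex $i$ as $\sigma(i)$ (variable at $i$ moves to $\sigma(i)$); e.g. $(54321)$ sends $1\mapsto5$ and $i\mapsto i-1$ for $i\ge2$. Operations compose left to right (leftmost first): $\rho_1=\mu_1\circ(54321)$,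 $\rho_2=\mu_5\circ(12345)$, $\rho_3=\mu_2\circ\mu_4\circ(24)$. In a product $\rho_a\rho_b$, $\rho_a$ is applied first; powers are repeated products, and $\rho^0$ is the identity. *)

theory Defs
  imports
    Complex_Main
    "HOL-Library.Poly_Mapping"
    "HOL-Computational_Algebra.Fraction_Field"
    "HOL-Combinatorics.Cycles"
begin

text \<open>The field of rational functions over the rationals in indeterminates indexed by natural
  numbers; only the indeterminates with index in {1..5} are used.\<close>

type_synonym ratfun = "((nat \<Rightarrow>\<^sub>0 nat) \<Rightarrow>\<^sub>0 rat) fract"

definition indet :: "nat \<Rightarrow> ratfun" where
  "indet i = Fract (Poly_Mapping.single (Poly_Mapping.single i 1) 1) 1"

definition verts :: "nat set" where
  "verts = {1..5}"

text \<open>For \<open>a :: quiver\<close>, the number of arrows from \<open>i\<close> to \<open>j\<close> is \<open>a i j\<close>.\<close>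

type_synonym quiver = "nat \<Rightarrow> nat \<Rightarrow> nat"
type_synonym cluster = "nat \<Rightarrow> ratfun"
type_synonym seed = "quiver \<times> cluster"

text \<open>Absence of loops and 2-cycles is not built into the types; it holds for the
  quiver \<open>Q\<close> below and is preserved by mutation and relabelling.\<close>

definition valid_quiver :: "quiver \<Rightarrow> bool" where
  "valid_quiver a \<longleftrightarrow>
     (\<forall>i j. a i j \<noteq> 0 \<longrightarrow> i \<in> verts \<and> j \<in> verts) \<and>
     (\<forall>i. a i i = 0) \<and> (\<forall>i j. a i j = 0 \<or> a j i = 0)"

definition in_degree :: "quiver \<Rightarrow> nat \<Rightarrow> nat" where
  "in_degree a i = (\<Sum>j\<in>verts. a j i)"

definition out_degree :: "quiver \<Rightarrow> nat \<Rightarrow> nat" where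
  "out_degree a i = (\<Sum>j\<in>verts. a i j)"

definition toric :: "quiver \<Rightarrow> nat \<Rightarrow> bool" where
  "toric a i \<longleftrightarrow> in_degree a i = 2 \<and> out_degree a i = 2"

definition add_paths :: "nat \<Rightarrow> quiver \<Rightarrow> quiver" where
  "add_paths i a = (\<lambda>j k. a j k + a j i * a i k)"

definition reverse_at :: "nat \<Rightarrow> quiver \<Rightarrow> quiver" where
  "reverse_at i a = (\<lambda>j k. if j = i \<or> k = i then a k j else a j k)"

definition delete_two_cycles :: "quiver \<Rightarrow> quiver" where
  "delete_two_cycles a = (\<lambda>j k. a j k - min (a j k) (a k j))"

definition mutate_quiver :: "nat \<Rightarrow> quiver \<Rightarrow> quiver" where
  "mutate_quiver i a = delete_two_cycles (reverse_at i (add_paths i a))"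

definition mutate_cluster :: "nat \<Rightarrow> quiver \<Rightarrow> cluster \<Rightarrow> cluster" where
  "mutate_cluster i a y =
     y(i := ((\<Prod>j\<in>verts. y j ^ a i j) + (\<Prod>j\<in>verts. y j ^ a j i)) / y i)"

definition mutate :: "nat \<Rightarrow> seed \<Rightarrow> seed" where
  "mutate i s = (mutate_quiver i (fst s), mutate_cluster i (fst s) (snd s))"

text \<open>The vertex \<open>i\<close> becomes \<open>\<sigma> i\<close>, so the data at the new vertex \<open>i\<close> is the old data
  at \<open>inv \<sigma> i\<close>.\<close>

definition relabel :: "(nat \<Rightarrow> nat) \<Rightarrow> seed \<Rightarrow> seed" where
  "relabel \<sigma> s = ((\<lambda>i j. fst s (inv \<sigma> i) (inv \<sigma> j)), (\<lambda>i. snd s (inv \<sigma> i)))"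

fun toric_sequence :: "seed \<Rightarrow> nat list \<Rightarrow> bool" where
  "toric_sequence s [] = True"
| "toric_sequence s (i # is) =
     (i \<in> verts \<and> toric (fst s) i \<and> toric_sequence (mutate i s) is)"

definition quiver_iso :: "quiver \<Rightarrow> quiver \<Rightarrow> bool" where
  "quiver_iso a b \<longleftrightarrow>
     (\<exists>\<sigma>. bij_betw \<sigma> verts verts \<and> (\<forall>i\<in>verts. \<forall>j\<in>verts. b (\<sigma> i) (\<sigma> j) = a i j))"

definition opposite :: "quiver \<Rightarrow> quiver" where
  "opposite a = (\<lambda>i j. a j i)"

definition same_cluster :: "cluster \<Rightarrow> cluster \<Rightarrow> bool" where
  "same_cluster y z \<longleftrightarrow> (\<exists>\<pi>. \<pi> permutes verts \<and> (\<forall>i\<in>verts. y i = z (\<pi> i)))"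

definition Q :: quiver where
  "Q i j = count_list
     [(1,2), (1,5), (3,1), (4,1), (4,5), (5,2), (5,3), (2,3), (2,3), (3,4), (3,4)] (i, j)"

definition initial_seed :: seed where
  "initial_seed = (Q, indet)"

text \<open>Written with \<open>\<circ>\<close>, which applies its right-hand argument first, products of operations appear
  in the opposite order to the left-to-right convention \<open>\<rho>\<^sub>1 = \<mu>\<^sub>1 (54321)\<close>,
  \<open>\<rho>\<^sub>2 = \<mu>\<^sub>5 (12345)\<close>, \<open>\<rho>\<^sub>3 = \<mu>\<^sub>2 \<mu>\<^sub>4 (24)\<close>.\<close>

definition rho :: "nat \<Rightarrow> seed \<Rightarrow> seed" where
  "rho t =
     (if t = 1 then relabel (cycle_of_list [5,4,3,2,1]) \<circ> mutate 1
      else if t = 2 then relabel (cycle_of_list [1,2,3,4,5]) \<circ> mutate 5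
      else relabel (cycle_of_list [2,4]) \<circ> mutate 4 \<circ> mutate 2)"

text \<open>The word \<open>\<rho>\<^sub>t\<^sup>k (\<rho>\<^sub>3 \<rho>\<^sub>1)\<^sup>m \<rho>\<^sub>3\<^sup>w\<close>, with leftmost factor applied first.\<close>

definition rho_word :: "nat \<Rightarrow> nat \<Rightarrow> nat \<Rightarrow> nat \<Rightarrow> seed \<Rightarrow> seed" where
  "rho_word t k m w = (rho 3 ^^ w) \<circ> ((rho 1 \<circ> rho 3) ^^ m) \<circ> (rho t ^^ k)"

lemma cycle_54321:
  "cycle_of_list [5,4,3,2,1::nat] 1 = 5"
  "i \<in> {2..5} \<Longrightarrow> cycle_of_list [5,4,3,2,1::nat] i = i - 1"
proof -
  show "cycle_of_list [5,4,3,2,1::nat] 1 = 5"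
    by (simp add: transpose_def)
  assume "i \<in> {2..5}"
  then have "i = 2 \<or> i = 3 \<or> i = 4 \<or> i = 5" by auto
  then show "cycle_of_list [5,4,3,2,1::nat] i = i - 1"
    by (auto simp: transpose_def)
qed

lemma valid_quiver_Q: "valid_quiver Q"
  by (auto simp: valid_quiver_def Q_def verts_def split: if_splits)

lemma valid_quiver_mutate:
  assumes "valid_quiver a"
  shows "valid_quiver (mutate_quiver i a)"
proof -
  have supp: "a j k = 0" if "j \<notin> verts \<or> k \<notin> verts" for j k
    using assms that unfolding valid_quiver_def by metis
  have "mutate_quiver i a j k = 0" if "j \<notin> verts \<or> k \<notin> verts" for j k
    using supp that
    by (auto simp: mutate_quiver_def delete_two_cycles_def reverse_at_def add_paths_def)
  moreover have "mutate_quiver i a j j = 0" for j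
    by (simp add: mutate_quiver_def delete_two_cycles_def)
  moreover have "mutate_quiver i a j k = 0 \<or> mutate_quiver i a k j = 0" for j k
    unfolding mutate_quiver_def delete_two_cycles_def by linarith
  ultimately show ?thesis
    unfolding valid_quiver_def by metis
qed

lemma valid_quiver_relabel:
  assumes "valid_quiver (fst s)" and "\<sigma> permutes verts"
  shows "valid_quiver (fst (relabel \<sigma> s))"
  using assms permutes_in_image[OF permutes_inv[OF assms(2)]]
  unfolding valid_quiver_def relabel_def fst_conv by metis

end

theory Submission
  imports Defs
begin

text \<open>On seeds with quiver \<open>Q\<close> and subtraction-free (hence nonzero) cluster variables the moves satisfy
  \<open>\<rho>\<^sub>1 \<rho>\<^sub>2 = \<rho>\<^sub>2 \<rho>\<^sub>1 = \<rho>\<^sub>3\<^sup>2 = 1\<close>, and \<open>\<rho>\<^sub>1\<^sup>2\<close> commutes with \<open>\<rho>\<^sub>3\<close>.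
  Hence squares of \<open>\<rho>\<^sub>1\<close> can be moved to the front of any word in the \<open>\<rho>\<^sub>i\<close>, which leaves an
  alternating word in \<open>\<rho>\<^sub>3\<close> and \<open>\<rho>\<^sub>1\<close>.
  Up to relabelling, a toric sequence only visits seeds \<open>u\<close>, \<open>\<mu>\<^sub>2 u\<close>, \<open>\<mu>\<^sub>4 u\<close> with \<open>u\<close> obtained from
  the initial seed by such a word: the only toric mutations at \<open>\<mu>\<^sub>2 u\<close> that are not immediate are
  \<open>\<mu>\<^sub>1\<close>, where the pentagon relation gives \<open>\<mu>\<^sub>4\<close> of \<open>\<rho>\<^sub>1\<^sup>2 u\<close>, and symmetrically \<open>\<mu>\<^sub>5\<close> at
  \<open>\<mu>\<^sub>4 u\<close>. The quivers of \<open>\<mu>\<^sub>2 u\<close> and \<open>\<mu>\<^sub>4 u\<close> contain a triple arrow, so they are isomorphic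
  neither to \<open>Q\<close> nor to its opposite.\<close>

\<comment> \<open>Keeps the vertex label \<open>1\<close> from being rewritten to \<open>Suc 0\<close>.\<close>
declare One_nat_def [simp del]

text \<open>Serves exponents equal to 1, since \<open>1\<close> no longer unfolds to a
  successor.\<close>

lemma funpow_one [simp]: "f ^^ 1 = (f :: 'a \<Rightarrow> 'a)"
  by (simp add: One_nat_def)

section \<open>Subtraction-free rational functions\<close>

definition nonneg_polys :: "((nat \<Rightarrow>\<^sub>0 nat) \<Rightarrow>\<^sub>0 rat) set" where
  "nonneg_polys = {p. p \<noteq> 0 \<and> (\<forall>k. 0 \<le> Poly_Mapping.lookup p k)}"

text \<open>Closed under addition, multiplication and division but without \<open>0\<close>. This
  keeps every divisor in the exchange relations nonzero, which matters because
  \<open>x / 0 = 0\<close>.\<close>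

definition subtraction_free :: "ratfun set" where
  "subtraction_free = {Fract p q | p q. p \<in> nonneg_polys \<and> q \<in> nonneg_polys}"

text \<open>Nonnegative coefficients cannot cancel, so a monomial of \<open>p\<close> survives in
  the sum.\<close>

lemma nonneg_polys_add:
  assumes "p \<in> nonneg_polys" "q \<in> nonneg_polys"
  shows "p + q \<in> nonneg_polys"
proof -
  have nn: "0 \<le> Poly_Mapping.lookup p k" "0 \<le> Poly_Mapping.lookup q k" for k
    using assms by (auto simp: nonneg_polys_def)
  have "p \<noteq> 0" using assms by (simp add: nonneg_polys_def)
  then obtain k where "Poly_Mapping.lookup p k \<noteq> 0"
    by (metis lookup_zero poly_mapping_eqI)
  then have "Poly_Mapping.lookup (p + q) k > 0"
    using nn[of k] by (simp add: lookup_add)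
  then have "p + q \<noteq> 0" by force
  then show ?thesis
    using nn by (simp add: nonneg_polys_def lookup_add)
qed

lemma Sum_any_nonneg:
  fixes f :: "'a \<Rightarrow> 'b::ordered_comm_monoid_add"
  assumes "\<And>x. 0 \<le> f x"
  shows "0 \<le> Sum_any f"
  unfolding Sum_any.expand_set by (rule sum_nonneg) (rule assms)

lemma nonneg_polys_mult:
  assumes "p \<in> nonneg_polys" "q \<in> nonneg_polys"
  shows "p * q \<in> nonneg_polys"
  using assms unfolding nonneg_polys_def
  by (auto simp: lookup_mult when_def intro!: Sum_any_nonneg mult_nonneg_nonneg)

lemma one_nonneg_polys: "1 \<in> nonneg_polys"
  by (simp add: nonneg_polys_def lookup_one when_def)

lemma subtraction_free_indet: "indet i \<in> subtraction_free"
proof -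
  have "Poly_Mapping.single (Poly_Mapping.single i (1::nat)) (1::rat) \<noteq> 0"
    by (metis lookup_single_eq lookup_zero zero_neq_one)
  then have "Poly_Mapping.single (Poly_Mapping.single i 1) 1 \<in> nonneg_polys"
    by (simp add: nonneg_polys_def lookup_single when_def)
  then show ?thesis
    unfolding indet_def subtraction_free_def using one_nonneg_polys by blast
qed

lemma subtraction_free_nonzero: "x \<in> subtraction_free \<Longrightarrow> x \<noteq> 0"
  by (auto simp: subtraction_free_def nonneg_polys_def Zero_fract_def eq_fract)

lemma subtraction_free_add:
  assumes "x \<in> subtraction_free" "y \<in> subtraction_free"
  shows "x + y \<in> subtraction_free"
proof -
  obtain a b c d where "x = Fract a b" "y = Fract c d"
    and nn: "a \<in> nonneg_polys" "b \<in> nonneg_polys" "c \<in> nonneg_polys" "d \<in> nonneg_polys"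
    using assms by (auto simp: subtraction_free_def)
  moreover from nn have "b \<noteq> 0" "d \<noteq> 0" by (auto simp: nonneg_polys_def)
  ultimately have "x + y = Fract (a * d + c * b) (b * d)" by simp
  then show ?thesis
    unfolding subtraction_free_def using nn nonneg_polys_add nonneg_polys_mult by blast
qed

lemma subtraction_free_mult:
  assumes "x \<in> subtraction_free" "y \<in> subtraction_free"
  shows "x * y \<in> subtraction_free"
proof -
  obtain a b c d where "x = Fract a b" "y = Fract c d"
    and nn: "a \<in> nonneg_polys" "b \<in> nonneg_polys" "c \<in> nonneg_polys" "d \<in> nonneg_polys"
    using assms by (auto simp: subtraction_free_def)
  then have "x * y = Fract (a * c) (b * d)" by simp
  then show ?thesis
    unfolding subtraction_free_def using nn nonneg_polys_mult by blast
qed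

lemma subtraction_free_divide:
  assumes "x \<in> subtraction_free" "y \<in> subtraction_free"
  shows "x / y \<in> subtraction_free"
proof -
  obtain a b c d where "x = Fract a b" "y = Fract c d"
    and nn: "a \<in> nonneg_polys" "b \<in> nonneg_polys" "c \<in> nonneg_polys" "d \<in> nonneg_polys"
    using assms by (auto simp: subtraction_free_def)
  then have "x / y = Fract (a * d) (b * c)" by simp
  then show ?thesis
    unfolding subtraction_free_def using nn nonneg_polys_mult by blast
qed

lemmas subtraction_free_intros =
  subtraction_free_add subtraction_free_mult subtraction_free_divide

section \<open>Relabelling\<close>

text \<open>Composing with \<pi> itself instead of its inverse lets concrete relabellings be
  evaluated entry by entry.\<close>

definition pull :: "(nat \<Rightarrow> nat) \<Rightarrow> seed \<Rightarrow> seed" where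
  "pull \<pi> s = ((\<lambda>i j. fst s (\<pi> i) (\<pi> j)), (\<lambda>i. snd s (\<pi> i)))"

lemma relabel_eq_pull: "relabel \<sigma> = pull (inv \<sigma>)"
  by (simp add: relabel_def pull_def fun_eq_iff)

lemma pull_pull: "pull \<pi> (pull \<tau> s) = pull (\<tau> \<circ> \<pi>) s"
  by (simp add: pull_def)

lemma pull_id: "pull id s = s"
  by (simp add: pull_def)

lemma pull_relabel:
  assumes "\<sigma> permutes A"
  shows "pull \<sigma> (relabel \<sigma> s) = s"
  by (simp add: relabel_eq_pull pull_pull permutes_inv_o(2)[OF assms] pull_id)

lemma degree_pull:
  assumes "\<pi> permutes verts"
  shows "in_degree (fst (pull \<pi> s)) i = in_degree (fst s) (\<pi> i)"
    and "out_degree (fst (pull \<pi> s)) i = out_degree (fst s) (\<pi> i)"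
  unfolding in_degree_def out_degree_def pull_def
  using sum.permute[OF assms, of "\<lambda>j. fst s j (\<pi> i)"] sum.permute[OF assms, of "\<lambda>j. fst s (\<pi> i) j"]
  by (simp_all add: o_def)

lemma toric_pull:
  assumes "\<pi> permutes verts"
  shows "toric (fst (pull \<pi> s)) i = toric (fst s) (\<pi> i)"
  by (simp add: toric_def degree_pull[OF assms])

text \<open>Mutation does not see vertex names: injectivity of \<pi> preserves the comparisons with
  \<open>i\<close>, and the exchange products are reindexed over \<open>verts\<close>.\<close>

lemma mutate_pull:
  assumes "\<pi> permutes verts"
  shows "mutate i (pull \<pi> s) = pull \<pi> (mutate (\<pi> i) s)"
proof -
  have inj: "\<pi> j = \<pi> k \<longleftrightarrow> j = k" for j k
    using permutes_inj[OF assms] by (auto dest: injD)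
  show ?thesis
    using prod.permute[OF assms, of "\<lambda>j. snd s j ^ fst s j (\<pi> i)"]
      prod.permute[OF assms, of "\<lambda>j. snd s j ^ fst s (\<pi> i) j"]
    by (simp add: mutate_def pull_def mutate_quiver_def delete_two_cycles_def reverse_at_def
        add_paths_def mutate_cluster_def fun_eq_iff inj o_def)
qed

section \<open>The moves on seeds with quiver \<open>Q\<close>\<close>

lemma verts_eq: "verts = {1, 2, 3, 4, 5}"
  by (auto simp: verts_def)

text \<open>Valid quivers vanish outside \<open>verts\<close>, so 25 entries decide
  equality.\<close>

lemma quiver_eqI:
  assumes "valid_quiver a" "valid_quiver b"
    and "\<And>i j. i \<in> verts \<Longrightarrow> j \<in> verts \<Longrightarrow> a i j = b i j"
  shows "a = b"
proof (intro ext)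
  fix i j
  show "a i j = b i j"
    using assms unfolding valid_quiver_def by metis
qed

lemma permutes_vertsI:
  assumes "\<And>i. i \<notin> verts \<Longrightarrow> \<pi> i = i" "\<pi> ` verts = verts"
  shows "\<pi> permutes verts"
proof (rule bij_imp_permutes)
  have "finite verts" by (simp add: verts_def)
  then show "bij_betw \<pi> verts verts"
    using assms(2) eq_card_imp_inj_on[of verts \<pi>] by (simp add: bij_betw_def)
qed (use assms in auto)

lemma rotation_permutes:
  "cycle_of_list [5,4,3,2,1::nat] permutes verts"
  "cycle_of_list [1,2,3,4,5::nat] permutes verts"
  "cycle_of_list [2,4::nat] permutes verts"
  by (rule permutes_vertsI; auto simp: verts_eq transpose_def)+

lemma inv_rotations:
  "inv (cycle_of_list [5,4,3,2,1::nat]) = id(1 := 2, 2 := 3, 3 := 4, 4 := 5, 5 := 1)"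
  "inv (cycle_of_list [1,2,3,4,5::nat]) = id(1 := 5, 2 := 1, 3 := 2, 4 := 3, 5 := 4)"
  "inv (cycle_of_list [2,4::nat]) = id(2 := 4, 4 := 2)"
  by (rule inv_unique_comp; auto simp: fun_eq_iff transpose_def)+

text \<open>On naturals \<open>x - min x y\<close> is the truncated difference \<open>x - y\<close>,
  so cancelling 2-cycles is plain subtraction.\<close>

lemma mutate_quiver_entry:
  "mutate_quiver i a j k =
    (if j = i \<or> k = i then a k j + a k i * a i j - (a j k + a j i * a i k)
     else a j k + a j i * a i k - (a k j + a k i * a i j))"
  by (auto simp: mutate_quiver_def delete_two_cycles_def reverse_at_def add_paths_def min_def)

section \<open>Arrow tables of \<open>Q\<close> and of its mutations at 2 and 4\<close>

lemma Q_entries: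
  "Q 1 1 = 0" "Q 1 2 = 1" "Q 1 3 = 0" "Q 1 4 = 0" "Q 1 5 = 1"
  "Q 2 1 = 0" "Q 2 2 = 0" "Q 2 3 = 2" "Q 2 4 = 0" "Q 2 5 = 0"
  "Q 3 1 = 1" "Q 3 2 = 0" "Q 3 3 = 0" "Q 3 4 = 2" "Q 3 5 = 0"
  "Q 4 1 = 1" "Q 4 2 = 0" "Q 4 3 = 0" "Q 4 4 = 0" "Q 4 5 = 1"
  "Q 5 1 = 0" "Q 5 2 = 1" "Q 5 3 = 1" "Q 5 4 = 0" "Q 5 5 = 0"
  by (simp_all add: Q_def)

definition Q2 :: quiver where "Q2 = mutate_quiver 2 Q"

definition Q4 :: quiver where "Q4 = mutate_quiver 4 Q"

lemma Q2_entries: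
  "Q2 1 1 = 0" "Q2 1 2 = 0" "Q2 1 3 = 1" "Q2 1 4 = 0" "Q2 1 5 = 1"
  "Q2 2 1 = 1" "Q2 2 2 = 0" "Q2 2 3 = 0" "Q2 2 4 = 0" "Q2 2 5 = 1"
  "Q2 3 1 = 0" "Q2 3 2 = 2" "Q2 3 3 = 0" "Q2 3 4 = 2" "Q2 3 5 = 0"
  "Q2 4 1 = 1" "Q2 4 2 = 0" "Q2 4 3 = 0" "Q2 4 4 = 0" "Q2 4 5 = 1"
  "Q2 5 1 = 0" "Q2 5 2 = 0" "Q2 5 3 = 3" "Q2 5 4 = 0" "Q2 5 5 = 0"
  by (simp_all add: Q2_def mutate_quiver_entry Q_entries)

lemma Q4_entries:
  "Q4 1 1 = 0" "Q4 1 2 = 1" "Q4 1 3 = 0" "Q4 1 4 = 1" "Q4 1 5 = 1"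
  "Q4 2 1 = 0" "Q4 2 2 = 0" "Q4 2 3 = 2" "Q4 2 4 = 0" "Q4 2 5 = 0"
  "Q4 3 1 = 3" "Q4 3 2 = 0" "Q4 3 3 = 0" "Q4 3 4 = 0" "Q4 3 5 = 1"
  "Q4 4 1 = 0" "Q4 4 2 = 0" "Q4 4 3 = 2" "Q4 4 4 = 0" "Q4 4 5 = 0"
  "Q4 5 1 = 0" "Q4 5 2 = 1" "Q4 5 3 = 0" "Q4 5 4 = 1" "Q4 5 5 = 0"
  by (simp_all add: Q4_def mutate_quiver_entry Q_entries)

lemmas entries = Q_entries Q2_entries Q4_entries

lemma valid_Q2: "valid_quiver Q2" and valid_Q4: "valid_quiver Q4"
  by (simp_all add: Q2_def Q4_def valid_quiver_mutate valid_quiver_Q)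

text \<open>In \<open>Q\<close> vertex 3 has in-degree 3. In \<open>Q2\<close> and \<open>Q4\<close>
  the excluded vertices are the end points of the triple arrow, 5 to 3 and 3 to 1
  respectively.\<close>

lemma toric_Q: "i \<in> verts \<Longrightarrow> toric Q i \<Longrightarrow> i \<in> {1, 2, 4, 5}"
  and toric_Q2: "i \<in> verts \<Longrightarrow> toric Q2 i \<Longrightarrow> i \<in> {1, 2, 4}"
  and toric_Q4: "i \<in> verts \<Longrightarrow> toric Q4 i \<Longrightarrow> i \<in> {2, 4, 5}"
  by (auto simp: verts_eq toric_def in_degree_def out_degree_def entries)

lemma mutate_Q:
  "mutate 2 (Q, y) = (Q2, y(2 := (y 1 * y 5 + y 3 ^ 2) / y 2))"
  "mutate 4 (Q, y) = (Q4, y(4 := (y 1 * y 5 + y 3 ^ 2) / y 4))"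
  by (simp_all add: mutate_def Q2_def Q4_def mutate_cluster_def verts_eq entries add.commute)

text \<open>Mutation is an involution, and no arrow joins 2 and 4, so mutations there
  commute.\<close>

lemma mutate_quiver_mutate_quiver:
  "mutate_quiver 2 Q2 = Q" "mutate_quiver 4 Q4 = Q" "mutate_quiver 2 Q4 = mutate_quiver 4 Q2"
  by (rule quiver_eqI;
      auto simp: valid_Q2 valid_Q4 valid_quiver_Q valid_quiver_mutate verts_eq mutate_quiver_entry entries)+

lemma valid_quiver_pull:
  assumes "valid_quiver (fst s)" "\<pi> permutes verts"
  shows "valid_quiver (fst (pull \<pi> s))"
  using assms permutes_in_image[OF assms(2)]
  unfolding valid_quiver_def pull_def fst_conv by metis

section \<open>Explicit formulas for the three moves\<close>

lemma rho_eq_pull: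
  "rho 1 s = pull (id(1 := 2, 2 := 3, 3 := 4, 4 := 5, 5 := 1)) (mutate 1 s)"
  "rho 2 s = pull (id(1 := 5, 2 := 1, 3 := 2, 4 := 3, 5 := 4)) (mutate 5 s)"
  "rho 3 s = pull (id(2 := 4, 4 := 2)) (mutate 4 (mutate 2 s))"
  unfolding rho_def relabel_eq_pull inv_rotations by simp_all

text \<open>The first three are the inverses of the cycles in the moves; the last two occur in the
  pentagon relations.\<close>

lemma relabellings_permute:
  "id(1 := 2, 2 := 3, 3 := 4, 4 := 5, 5 := 1) permutes verts"
  "id(1 := 5, 2 := 1, 3 := 2, 4 := 3, 5 := 4) permutes verts"
  "id(2 := 4, 4 := 2) permutes verts"
  "id(1 := 5, 2 := 4, 3 := 1, 4 := 2, 5 := 3) permutes verts"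
  "id(1 := 3, 2 := 4, 3 := 5, 4 := 2, 5 := 1) permutes verts"
  by (rule permutes_vertsI; auto simp: verts_eq)+

text \<open>Mutation at 1 only rotates \<open>Q\<close>, so the move shifts the cluster along the
  Somos-5 recurrence \<open>x(n+5) x(n) = x(n+1) x(n+4) + x(n+2) x(n+3)\<close>.\<close>

lemma rho1: "rho 1 (Q, y) =
    (Q, y(1 := y 2, 2 := y 3, 3 := y 4, 4 := y 5, 5 := (y 2 * y 5 + y 3 * y 4) / y 1))"
proof -
  have "fst (rho 1 (Q, y)) = Q"
    unfolding rho_eq_pull
    by (rule quiver_eqI[OF valid_quiver_pull[OF _ relabellings_permute(1)] valid_quiver_Q])
      (auto simp: mutate_def valid_quiver_mutate valid_quiver_Q pull_def verts_eq
        mutate_quiver_entry entries)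
  moreover have "snd (rho 1 (Q, y)) =
      y(1 := y 2, 2 := y 3, 3 := y 4, 4 := y 5, 5 := (y 2 * y 5 + y 3 * y 4) / y 1)"
    unfolding rho_eq_pull
    by (auto simp: mutate_def pull_def mutate_cluster_def verts_eq entries fun_eq_iff)
  ultimately show ?thesis by (simp add: prod_eq_iff)
qed

text \<open>The Somos-5 recurrence run backwards.\<close>

lemma rho2: "rho 2 (Q, y) =
    (Q, y(1 := (y 2 * y 3 + y 1 * y 4) / y 5, 2 := y 1, 3 := y 2, 4 := y 3, 5 := y 4))"
proof -
  have "fst (rho 2 (Q, y)) = Q"
    unfolding rho_eq_pull
    by (rule quiver_eqI[OF valid_quiver_pull[OF _ relabellings_permute(2)] valid_quiver_Q])
      (auto simp: mutate_def valid_quiver_mutate valid_quiver_Q pull_def verts_eq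
        mutate_quiver_entry entries)
  moreover have "snd (rho 2 (Q, y)) =
      y(1 := (y 2 * y 3 + y 1 * y 4) / y 5, 2 := y 1, 3 := y 2, 4 := y 3, 5 := y 4)"
    unfolding rho_eq_pull
    by (auto simp: mutate_def pull_def mutate_cluster_def verts_eq entries fun_eq_iff)
  ultimately show ?thesis by (simp add: prod_eq_iff)
qed

text \<open>Vertices 2 and 4 share one exchange numerator, which involves neither of their own
  variables; the first mutation therefore leaves it intact for the second.\<close>

lemma rho3: "rho 3 (Q, y) =
    (Q, y(2 := (y 1 * y 5 + y 3 ^ 2) / y 4, 4 := (y 1 * y 5 + y 3 ^ 2) / y 2))"
proof -
  have "fst (rho 3 (Q, y)) = Q"
    unfolding rho_eq_pull mutate_Q
    by (rule quiver_eqI[OF valid_quiver_pull[OF _ relabellings_permute(3)] valid_quiver_Q])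
      (auto simp: mutate_def valid_quiver_mutate valid_Q2 pull_def verts_eq
        mutate_quiver_entry entries)
  moreover have "snd (rho 3 (Q, y)) =
      y(2 := (y 1 * y 5 + y 3 ^ 2) / y 4, 4 := (y 1 * y 5 + y 3 ^ 2) / y 2)"
    unfolding rho_eq_pull mutate_Q
    by (auto simp: mutate_def pull_def mutate_cluster_def verts_eq entries fun_eq_iff add.commute)
  ultimately show ?thesis by (simp add: prod_eq_iff)
qed

section \<open>Relations\<close>

text \<open>Nonzero entries alone would not be an invariant, since an exchange numerator could
  vanish; subtraction-free entries are.\<close>

definition Q_seed :: "seed \<Rightarrow> bool" where
  "Q_seed s \<longleftrightarrow> fst s = Q \<and> (\<forall>i\<in>verts. snd s i \<in> subtraction_free)"

lemma Q_seedE: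
  assumes "Q_seed s"
  obtains y where "s = (Q, y)" "\<forall>i\<in>verts. y i \<in> subtraction_free"
  using assms that[of "snd s"] unfolding Q_seed_def by (cases s) auto

lemma Q_seed_initial: "Q_seed initial_seed"
  by (simp add: Q_seed_def initial_seed_def subtraction_free_indet)

lemma Q_seed_rho:
  assumes "Q_seed s" "t \<in> {1, 2, 3}"
  shows "Q_seed (rho t s)"
proof -
  obtain y where s: "s = (Q, y)" and "\<forall>i\<in>verts. y i \<in> subtraction_free"
    using assms(1) by (rule Q_seedE)
  then have "y 1 \<in> subtraction_free" "y 2 \<in> subtraction_free" "y 3 \<in> subtraction_free"
    "y 4 \<in> subtraction_free" "y 5 \<in> subtraction_free"
    by (simp_all add: verts_eq)
  then show ?thesis
    using assms(2) unfolding s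
    by (auto simp: rho1 rho2 rho3
        Q_seed_def verts_eq power2_eq_square
        intro!: subtraction_free_intros)
qed

text \<open>Here \<open>a, ..., e\<close> is a cluster, \<open>f\<close> and \<open>g\<close> are
  the next two Somos-5 terms, and \<open>a * e + c ^ 2\<close> is the exchange numerator at 2 and 4.
  The first three identities make \<open>rho 3\<close> commute with two Somos steps; the first and
  last give the pentagon relation.\<close>

lemma exchange_identities:
  fixes a b c d e f g :: "'a::field"
  assumes "a \<noteq> 0" "b \<noteq> 0" "d \<noteq> 0" "f \<noteq> 0" "a * e + c ^ 2 \<noteq> 0"
    and f: "f = (b * e + c * d) / a" and g: "g = (c * f + d * e) / b"
  shows "(c * g + e ^ 2) / f = (a * e + c ^ 2) / b"
    and "(c * g + e ^ 2) / d = ((a * e + c ^ 2) / d * e + c * ((a * e + c ^ 2) / b)) / a"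
    and "g = (c * ((c * g + e ^ 2) / d) + (a * e + c ^ 2) / b * e) / ((a * e + c ^ 2) / d)"
    and "g = (c * e + (a * e + c ^ 2) / b * d) / a"
proof -
  define X where "X = a * e + c ^ 2"
  have af: "a * f = b * e + c * d" and bg: "b * g = c * f + d * e"
    using assms by simp_all
  \<comment> \<open>Two Somos steps multiply the numerator \<open>X\<close> by \<open>f / b\<close>;
    the first three identities follow from this.\<close>
  have "b * (c * g + e ^ 2) = f * X"
    unfolding X_def using af bg by algebra
  then have key: "c * g + e ^ 2 = f * X / b"
    using \<open>b \<noteq> 0\<close> by (simp add: field_simps)
  have "X \<noteq> 0" using assms by (simp add: X_def)
  show "(c * g + e ^ 2) / f = (a * e + c ^ 2) / b"
    unfolding key X_def using \<open>f \<noteq> 0\<close> by simp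
  have "X / d * e + c * (X / b) = X * (a * f) / (b * d)"
    unfolding af using assms(1-3) by (simp add: field_simps)
  then show "(c * g + e ^ 2) / d = ((a * e + c ^ 2) / d * e + c * ((a * e + c ^ 2) / b)) / a"
    unfolding key X_def[symmetric] using \<open>a \<noteq> 0\<close> by simp
  have "c * (f * X / b / d) + X / b * e = X / d * ((c * f + d * e) / b)"
    using assms(1-3) by (simp add: field_simps)
  then show "g = (c * ((c * g + e ^ 2) / d) + (a * e + c ^ 2) / b * e) / ((a * e + c ^ 2) / d)"
    unfolding key X_def[symmetric] using \<open>X \<noteq> 0\<close> \<open>d \<noteq> 0\<close> g by simp
  have "a * (b * g) = b * c * e + X * d"
    unfolding X_def using af bg by algebra
  then show "g = (c * e + (a * e + c ^ 2) / b * d) / a"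
    unfolding X_def[symmetric] using assms(1-2) by (simp add: field_simps)
qed

context
  fixes s :: seed
  assumes Q_seed: "Q_seed s"
begin

text \<open>The three sums are the exchange numerators of the moves. They must be nonzero because a
  later move divides by the variables built from them.\<close>

lemma explicit_cluster:
  obtains y where "s = (Q, y)"
    "y 1 \<noteq> 0" "y 2 \<noteq> 0" "y 3 \<noteq> 0" "y 4 \<noteq> 0" "y 5 \<noteq> 0"
    "y 2 * y 5 + y 3 * y 4 \<noteq> 0" "y 2 * y 3 + y 1 * y 4 \<noteq> 0" "y 1 * y 5 + y 3 ^ 2 \<noteq> 0"
proof -
  obtain y where s: "s = (Q, y)" and "\<forall>i\<in>verts. y i \<in> subtraction_free"
    using Q_seed by (rule Q_seedE)
  then have pos: "y 1 \<in> subtraction_free" "y 2 \<in> subtraction_free" "y 3 \<in> subtraction_free"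
    "y 4 \<in> subtraction_free" "y 5 \<in> subtraction_free"
    by (simp_all add: verts_eq)
  show thesis
    by (rule that[OF s]; rule subtraction_free_nonzero;
        simp add: power2_eq_square subtraction_free_intros pos)
qed

lemma rho2_rho1: "rho 2 (rho 1 s) = s"
proof -
  obtain y where s: "s = (Q, y)" "y 1 \<noteq> 0" "y 2 \<noteq> 0" "y 3 \<noteq> 0" "y 4 \<noteq> 0" "y 5 \<noteq> 0"
    "y 2 * y 5 + y 3 * y 4 \<noteq> 0" "y 2 * y 3 + y 1 * y 4 \<noteq> 0" "y 1 * y 5 + y 3 ^ 2 \<noteq> 0"
    by (rule explicit_cluster)
  show ?thesis
    unfolding s(1) rho1 rho2 using s(2-) by (auto simp: fun_eq_iff field_simps)
qed

lemma rho1_rho2: "rho 1 (rho 2 s) = s"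
proof -
  obtain y where s: "s = (Q, y)" "y 1 \<noteq> 0" "y 2 \<noteq> 0" "y 3 \<noteq> 0" "y 4 \<noteq> 0" "y 5 \<noteq> 0"
    "y 2 * y 5 + y 3 * y 4 \<noteq> 0" "y 2 * y 3 + y 1 * y 4 \<noteq> 0" "y 1 * y 5 + y 3 ^ 2 \<noteq> 0"
    by (rule explicit_cluster)
  show ?thesis
    unfolding s(1) rho1 rho2 using s(2-) by (auto simp: fun_eq_iff field_simps)
qed

lemma rho3_rho3: "rho 3 (rho 3 s) = s"
proof -
  obtain y where s: "s = (Q, y)" "y 1 \<noteq> 0" "y 2 \<noteq> 0" "y 3 \<noteq> 0" "y 4 \<noteq> 0" "y 5 \<noteq> 0"
    "y 2 * y 5 + y 3 * y 4 \<noteq> 0" "y 2 * y 3 + y 1 * y 4 \<noteq> 0" "y 1 * y 5 + y 3 ^ 2 \<noteq> 0"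
    by (rule explicit_cluster)
  show ?thesis
    unfolding s(1) rho3 using s(2-) by (auto simp: fun_eq_iff field_simps)
qed

lemma rho1_rho1_rho3: "rho 1 (rho 1 (rho 3 s)) = rho 3 (rho 1 (rho 1 s))"
proof -
  obtain y where s: "s = (Q, y)" "y 1 \<noteq> 0" "y 2 \<noteq> 0" "y 3 \<noteq> 0" "y 4 \<noteq> 0" "y 5 \<noteq> 0"
    "y 2 * y 5 + y 3 * y 4 \<noteq> 0" "y 2 * y 3 + y 1 * y 4 \<noteq> 0" "y 1 * y 5 + y 3 ^ 2 \<noteq> 0"
    by (rule explicit_cluster)
  \<comment> \<open>The sixth and seventh Somos-5 terms, continuing
    \<open>y 1, ..., y 5\<close>.\<close>
  define f where "f = (y 2 * y 5 + y 3 * y 4) / y 1"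
  define g where "g = (y 3 * f + y 4 * y 5) / y 2"
  have "f \<noteq> 0" using s by (simp add: f_def)
  note ids = exchange_identities[OF \<open>y 1 \<noteq> 0\<close> \<open>y 2 \<noteq> 0\<close> \<open>y 4 \<noteq> 0\<close> this s(9) f_def g_def]
  have rho11: "rho 1 (rho 1 s) = (Q, y(1 := y 3, 2 := y 4, 3 := y 5, 4 := f, 5 := g))"
    by (auto simp: s(1) rho1 f_def g_def fun_eq_iff)
  have "rho 1 (rho 1 (rho 3 s)) = (Q, y(1 := y 3, 2 := (y 1 * y 5 + y 3 ^ 2) / y 2, 3 := y 5,
      4 := (y 3 * g + y 5 ^ 2) / y 4, 5 := g))"
    using ids(3) ids(2)[symmetric]
    by (auto simp: s(1) rho1 rho3 fun_eq_iff)
  also have "\<dots> = rho 3 (rho 1 (rho 1 s))"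
    unfolding rho11 rho3 using ids(1) by (auto simp: fun_eq_iff)
  finally show ?thesis .
qed

text \<open>Pentagon relation for the single arrow from 1 to 2: mutating at 2, 1 agrees with
  mutating at 1, 2, 1 up to swapping these vertices. After two rotations the old vertex 1 sits at 4
  and the old vertex 2 at 5; the permutation undoes the rotations and includes the swap.\<close>

lemma mutate_1_mutate_2:
  "mutate 1 (mutate 2 s) =
    pull (id(1 := 5, 2 := 4, 3 := 1, 4 := 2, 5 := 3)) (mutate 4 (rho 1 (rho 1 s)))"
proof -
  obtain y where s: "s = (Q, y)" "y 1 \<noteq> 0" "y 2 \<noteq> 0" "y 3 \<noteq> 0" "y 4 \<noteq> 0" "y 5 \<noteq> 0"
    "y 2 * y 5 + y 3 * y 4 \<noteq> 0" "y 2 * y 3 + y 1 * y 4 \<noteq> 0" "y 1 * y 5 + y 3 ^ 2 \<noteq> 0"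
    by (rule explicit_cluster)
  define f where "f = (y 2 * y 5 + y 3 * y 4) / y 1"
  define g where "g = (y 3 * f + y 4 * y 5) / y 2"
  have "f \<noteq> 0" using s by (simp add: f_def)
  note ids = exchange_identities[OF \<open>y 1 \<noteq> 0\<close> \<open>y 2 \<noteq> 0\<close> \<open>y 4 \<noteq> 0\<close> this s(9) f_def g_def]
  have rho11: "rho 1 (rho 1 s) = (Q, y(1 := y 3, 2 := y 4, 3 := y 5, 4 := f, 5 := g))"
    by (auto simp: s(1) rho1 f_def g_def fun_eq_iff)
  have "fst (mutate 1 (mutate 2 s)) =
    fst (pull (id(1 := 5, 2 := 4, 3 := 1, 4 := 2, 5 := 3)) (mutate 4 (rho 1 (rho 1 s))))"
    unfolding rho11 unfolding s(1) mutate_Q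
    by (rule quiver_eqI[OF _ valid_quiver_pull[OF _ relabellings_permute(4)]])
      (auto simp: mutate_def valid_quiver_mutate valid_Q2 valid_Q4 pull_def verts_eq
        mutate_quiver_entry entries)
  moreover have "snd (mutate 1 (mutate 2 s)) =
    snd (pull (id(1 := 5, 2 := 4, 3 := 1, 4 := 2, 5 := 3)) (mutate 4 (rho 1 (rho 1 s))))"
    unfolding rho11 unfolding s(1) mutate_Q using ids(1) ids(4)
    by (auto simp: mutate_def pull_def mutate_cluster_def verts_eq entries fun_eq_iff)
  ultimately show ?thesis by (simp add: prod_eq_iff)
qed

text \<open>Mirror image of the previous relation: sending \<open>i\<close> to \<open>6 - i\<close>
  and reversing all arrows preserves \<open>Q\<close>. The identities are used with
  \<open>y 5, ..., y 1\<close> for \<open>a, ..., e\<close>.\<close>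

lemma mutate_5_mutate_4:
  "mutate 5 (mutate 4 s) =
    pull (id(1 := 3, 2 := 4, 3 := 5, 4 := 2, 5 := 1)) (mutate 2 (rho 2 (rho 2 s)))"
proof -
  obtain y where s: "s = (Q, y)" "y 1 \<noteq> 0" "y 2 \<noteq> 0" "y 3 \<noteq> 0" "y 4 \<noteq> 0" "y 5 \<noteq> 0"
    "y 2 * y 5 + y 3 * y 4 \<noteq> 0" "y 2 * y 3 + y 1 * y 4 \<noteq> 0" "y 1 * y 5 + y 3 ^ 2 \<noteq> 0"
    by (rule explicit_cluster)
  define f where "f = (y 4 * y 1 + y 3 * y 2) / y 5"
  define g where "g = (y 3 * f + y 2 * y 1) / y 4"
  have nz: "f \<noteq> 0" "y 5 * y 1 + y 3 ^ 2 \<noteq> 0"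
    using s by (simp_all add: f_def add.commute mult.commute)
  note ids = exchange_identities[OF \<open>y 5 \<noteq> 0\<close> \<open>y 4 \<noteq> 0\<close> \<open>y 2 \<noteq> 0\<close> nz f_def g_def]
  have rho22: "rho 2 (rho 2 s) = (Q, y(1 := g, 2 := f, 3 := y 1, 4 := y 2, 5 := y 3))"
    by (auto simp: s(1) rho2 f_def g_def fun_eq_iff add.commute mult.commute)
  have "fst (mutate 5 (mutate 4 s)) =
    fst (pull (id(1 := 3, 2 := 4, 3 := 5, 4 := 2, 5 := 1)) (mutate 2 (rho 2 (rho 2 s))))"
    unfolding rho22 unfolding s(1) mutate_Q
    by (rule quiver_eqI[OF _ valid_quiver_pull[OF _ relabellings_permute(5)]])
      (auto simp: mutate_def valid_quiver_mutate valid_Q2 valid_Q4 pull_def verts_eq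
        mutate_quiver_entry entries)
  moreover have "snd (mutate 5 (mutate 4 s)) =
    snd (pull (id(1 := 3, 2 := 4, 3 := 5, 4 := 2, 5 := 1)) (mutate 2 (rho 2 (rho 2 s))))"
    unfolding rho22 unfolding s(1) mutate_Q using ids(1) ids(4)
    by (auto simp: mutate_def pull_def mutate_cluster_def verts_eq entries fun_eq_iff
        add.commute mult.commute)
  ultimately show ?thesis by (simp add: prod_eq_iff)
qed

lemma mutate_2_mutate_2: "mutate 2 (mutate 2 s) = s"
proof -
  obtain y where s: "s = (Q, y)" "y 1 \<noteq> 0" "y 2 \<noteq> 0" "y 3 \<noteq> 0" "y 4 \<noteq> 0" "y 5 \<noteq> 0"
    "y 2 * y 5 + y 3 * y 4 \<noteq> 0" "y 2 * y 3 + y 1 * y 4 \<noteq> 0" "y 1 * y 5 + y 3 ^ 2 \<noteq> 0"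
    by (rule explicit_cluster)
  show ?thesis
    unfolding s(1) mutate_Q using s(2-)
    by (auto simp: mutate_def mutate_quiver_mutate_quiver mutate_cluster_def verts_eq entries
        fun_eq_iff field_simps)
qed

lemma mutate_4_mutate_4: "mutate 4 (mutate 4 s) = s"
proof -
  obtain y where s: "s = (Q, y)" "y 1 \<noteq> 0" "y 2 \<noteq> 0" "y 3 \<noteq> 0" "y 4 \<noteq> 0" "y 5 \<noteq> 0"
    "y 2 * y 5 + y 3 * y 4 \<noteq> 0" "y 2 * y 3 + y 1 * y 4 \<noteq> 0" "y 1 * y 5 + y 3 ^ 2 \<noteq> 0"
    by (rule explicit_cluster)
  show ?thesis
    unfolding s(1) mutate_Q using s(2-)
    by (auto simp: mutate_def mutate_quiver_mutate_quiver mutate_cluster_def verts_eq entries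
        fun_eq_iff field_simps)
qed

lemma mutate_2_mutate_4: "mutate 2 (mutate 4 s) = mutate 4 (mutate 2 s)"
proof -
  obtain y where s: "s = (Q, y)"
    by (rule explicit_cluster)
  show ?thesis
    unfolding s(1) mutate_Q
    by (auto simp: mutate_def mutate_quiver_mutate_quiver mutate_cluster_def verts_eq entries
        fun_eq_iff)
qed

end

text \<open>Writing \<open>s\<close> as \<open>rho 1 (rho 1 x)\<close> reduces this to the
  commutation for \<open>rho 1\<close>, as \<open>rho 2\<close> inverts
  \<open>rho 1\<close>.\<close>

lemma rho2_rho2_rho3:
  assumes "Q_seed s"
  shows "rho 2 (rho 2 (rho 3 s)) = rho 3 (rho 2 (rho 2 s))"
proof -
  define x where "x = rho 2 (rho 2 s)"
  have x: "Q_seed x" "Q_seed (rho 2 s)" "Q_seed (rho 3 x)" "Q_seed (rho 1 (rho 3 x))"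
    using assms by (simp_all add: x_def Q_seed_rho)
  have "s = rho 1 (rho 1 x)"
    using assms x by (simp add: x_def rho1_rho2)
  then have "rho 3 s = rho 1 (rho 1 (rho 3 x))"
    using rho1_rho1_rho3[OF x(1)] by simp
  then show ?thesis
    using x by (simp add: rho2_rho1 flip: x_def)
qed

section \<open>Normal forms\<close>

text \<open>The orbit under all integer powers of \<open>rho 1\<close>, negative ones being powers
  of \<open>rho 2\<close>.\<close>

definition powers :: "seed set" where
  "powers = {(rho t ^^ k) initial_seed | t k. t \<in> {1, 2}}"

definition normal_forms :: "seed set" where
  "normal_forms = {(rho 3 ^^ w) (((rho 1 \<circ> rho 3) ^^ m) b) | w m b. w \<in> {0, 1} \<and> b \<in> powers}"

lemma normal_forms_eq_rho_words:
  "normal_forms = {rho_word t k m w initial_seed | t k m w. t \<in> {1, 2} \<and> w \<in> {0, 1}}"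
  unfolding normal_forms_def powers_def rho_word_def o_apply by blast

lemma Q_seed_powers: "b \<in> powers \<Longrightarrow> Q_seed b"
proof -
  have "Q_seed ((rho t ^^ k) initial_seed)" if "t \<in> {1, 2}" for t k
  proof (induction k)
    case (Suc k)
    then show ?case using Q_seed_rho[of "(rho t ^^ k) initial_seed" t] that by simp blast
  qed (simp add: Q_seed_initial)
  then show "b \<in> powers \<Longrightarrow> Q_seed b" by (auto simp: powers_def)
qed

lemma Q_seed_alternating:
  assumes "Q_seed s"
  shows "Q_seed (((rho 1 \<circ> rho 3) ^^ m) s)"
  using assms by (induction m) (simp_all add: Q_seed_rho)

lemma Q_seed_normal_forms: "u \<in> normal_forms \<Longrightarrow> Q_seed u"
  unfolding normal_forms_def
  by (auto simp: Q_seed_rho Q_seed_alternating Q_seed_powers)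

lemma powersI: "t \<in> {1, 2} \<Longrightarrow> (rho t ^^ k) initial_seed \<in> powers"
  unfolding powers_def by blast

text \<open>A power of \<open>rho 1\<close> grows, a nonempty power of \<open>rho 2\<close> loses
  its last factor, and the empty power becomes \<open>rho 1\<close>.\<close>

lemma rho1_powers: "b \<in> powers \<Longrightarrow> rho 1 b \<in> powers"
proof -
  have "rho 1 ((rho t ^^ k) initial_seed) \<in> powers" if t: "t \<in> {1, 2}" for t k
  proof (cases "t = 1")
    case True
    then show ?thesis using powersI[of 1 "Suc k"] by simp
  next
    case False
    then have t: "t = 2" using t by simp
    show ?thesis
    proof (cases k)
      case 0
      then show ?thesis using powersI[of 1 1] by simp
    next
      case (Suc k')
      have "(rho 2 ^^ k') initial_seed \<in> powers" by (rule powersI) simp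
      then show ?thesis
        unfolding t Suc using rho1_rho2[OF Q_seed_powers] by simp
    qed
  qed
  then show "b \<in> powers \<Longrightarrow> rho 1 b \<in> powers" unfolding powers_def by blast
qed

lemma rho2_powers: "b \<in> powers \<Longrightarrow> rho 2 b \<in> powers"
proof -
  have "rho 2 ((rho t ^^ k) initial_seed) \<in> powers" if t: "t \<in> {1, 2}" for t k
  proof (cases "t = 2")
    case True
    then show ?thesis using powersI[of 2 "Suc k"] by simp
  next
    case False
    then have t: "t = 1" using t by simp
    show ?thesis
    proof (cases k)
      case 0
      then show ?thesis using powersI[of 2 1] by simp
    next
      case (Suc k')
      have "(rho 1 ^^ k') initial_seed \<in> powers" by (rule powersI) simp
      then show ?thesis
        unfolding t Suc using rho2_rho1[OF Q_seed_powers] by simp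
    qed
  qed
  then show "b \<in> powers \<Longrightarrow> rho 2 b \<in> powers" unfolding powers_def by blast
qed

lemma alternating_Suc:
  "((rho 1 \<circ> rho 3) ^^ Suc m) s = rho 1 (rho 3 (((rho 1 \<circ> rho 3) ^^ m) s))"
  by simp

text \<open>The square passes \<open>rho 3\<close> by commutation and \<open>rho 1\<close>
  trivially.\<close>

lemma rho1_rho1_alternating:
  assumes "Q_seed s"
  shows "rho 1 (rho 1 (((rho 1 \<circ> rho 3) ^^ m) s)) = ((rho 1 \<circ> rho 3) ^^ m) (rho 1 (rho 1 s))"
proof (induction m)
  case (Suc m)
  then show ?case
    by (simp only: alternating_Suc rho1_rho1_rho3[OF Q_seed_alternating[OF assms]])
qed simp

lemma rho2_rho2_alternating:
  assumes "Q_seed s"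
  shows "rho 2 (rho 2 (((rho 1 \<circ> rho 3) ^^ m) s)) = ((rho 1 \<circ> rho 3) ^^ m) (rho 2 (rho 2 s))"
proof (induction m)
  case (Suc m)
  let ?x = "((rho 1 \<circ> rho 3) ^^ m) s"
  have x: "Q_seed ?x" by (rule Q_seed_alternating[OF assms])
  \<comment> \<open>Both sides collapse to \<open>rho 2 (rho 3 ?x)\<close>.\<close>
  have "rho 2 (rho 2 (rho 1 (rho 3 ?x))) = rho 1 (rho 2 (rho 2 (rho 3 ?x)))"
    using x by (simp add: rho2_rho1 rho1_rho2 Q_seed_rho)
  also have "\<dots> = rho 1 (rho 3 (rho 2 (rho 2 ?x)))"
    using x by (simp add: rho2_rho2_rho3)
  finally show ?case using Suc by (simp only: alternating_Suc)
qed simp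

lemma normal_formsI:
  assumes "b \<in> powers"
  shows "((rho 1 \<circ> rho 3) ^^ m) b \<in> normal_forms" "rho 3 (((rho 1 \<circ> rho 3) ^^ m) b) \<in> normal_forms"
proof -
  have "(rho 3 ^^ w) (((rho 1 \<circ> rho 3) ^^ m) b) \<in> normal_forms" if "w \<in> {0, 1}" for w
    unfolding normal_forms_def using that assms by blast
  from this[of 0] this[of 1] show "((rho 1 \<circ> rho 3) ^^ m) b \<in> normal_forms"
    "rho 3 (((rho 1 \<circ> rho 3) ^^ m) b) \<in> normal_forms" by simp_all
qed

lemma normal_formsE:
  assumes "u \<in> normal_forms"
  obtains m b where "b \<in> powers" "u = ((rho 1 \<circ> rho 3) ^^ m) b"
  | m b where "b \<in> powers" "u = rho 3 (((rho 1 \<circ> rho 3) ^^ m) b)"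
  using assms unfolding normal_forms_def by auto

lemma rho3_normal_forms:
  assumes "u \<in> normal_forms"
  shows "rho 3 u \<in> normal_forms"
  using assms
proof (cases rule: normal_formsE)
  case 1
  then show ?thesis by (simp only: normal_formsI)
next
  case 2
  then show ?thesis
    using rho3_rho3[OF Q_seed_alternating[OF Q_seed_powers]] by (simp only: normal_formsI)
qed

text \<open>After a final \<open>rho 3\<close>, the move completes another alternating factor. After
  a final \<open>rho 1\<close>, it forms a square that travels into the base \<open>b\<close>,
  leaving \<open>m - 1\<close> factors and a final \<open>rho 3\<close>.\<close>

lemma rho1_normal_forms:
  assumes "u \<in> normal_forms"
  shows "rho 1 u \<in> normal_forms"
  using assms
proof (cases rule: normal_formsE)
  case (1 m b)
  show ?thesis
  proof (cases m)
    case 0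
    then show ?thesis
      using 1 normal_formsI(1)[OF rho1_powers[OF 1(1)], of 0] by simp
  next
    case (Suc m')
    have b: "Q_seed b" using 1(1) by (rule Q_seed_powers)
    have "rho 1 u = rho 1 (rho 1 (rho 3 (((rho 1 \<circ> rho 3) ^^ m') b)))"
      using 1 Suc by simp
    also have "\<dots> = rho 3 (((rho 1 \<circ> rho 3) ^^ m') (rho 1 (rho 1 b)))"
      by (simp only: rho1_rho1_rho3[OF Q_seed_alternating[OF b]] rho1_rho1_alternating[OF b])
    finally show ?thesis
      by (simp only: normal_formsI rho1_powers 1(1))
  qed
next
  case (2 m b)
  then show ?thesis using normal_formsI(1)[of b "Suc m"] by simp
qed

lemma rho2_normal_forms:
  assumes "u \<in> normal_forms"
  shows "rho 2 u \<in> normal_forms"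
  using assms
proof (cases rule: normal_formsE)
  case (1 m b)
  show ?thesis
  proof (cases m)
    case 0
    then show ?thesis
      using 1 normal_formsI(1)[OF rho2_powers[OF 1(1)], of 0] by simp
  next
    case (Suc m')
    have "Q_seed (rho 3 (((rho 1 \<circ> rho 3) ^^ m') b))"
      using 1(1) by (simp add: Q_seed_rho Q_seed_alternating Q_seed_powers)
    then have "rho 2 u = rho 3 (((rho 1 \<circ> rho 3) ^^ m') b)"
      using 1 Suc by (simp add: rho2_rho1)
    then show ?thesis
      by (simp only: normal_formsI 1(1))
  qed
next
  case (2 m b)
  let ?x = "((rho 1 \<circ> rho 3) ^^ m) b"
  have b: "Q_seed b" using 2(1) by (rule Q_seed_powers)
  then have x: "Q_seed ?x" by (rule Q_seed_alternating)
  \<comment> \<open>Inserting \<open>rho 1\<close> after \<open>rho 2\<close> creates a square of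
    \<open>rho 2\<close> that can travel into the base; the inserted \<open>rho 1\<close> completes
    a factor with \<open>rho 3\<close>.\<close>
  then have "rho 2 u = rho 1 (rho 2 (rho 2 (rho 3 ?x)))"
    using 2 by (simp add: rho1_rho2 Q_seed_rho)
  also have "\<dots> = rho 1 (rho 3 (((rho 1 \<circ> rho 3) ^^ m) (rho 2 (rho 2 b))))"
    by (simp only: rho2_rho2_rho3[OF x] rho2_rho2_alternating[OF b])
  also have "\<dots> = ((rho 1 \<circ> rho 3) ^^ Suc m) (rho 2 (rho 2 b))"
    by simp
  finally show ?thesis
    by (simp only: normal_formsI rho2_powers 2(1))
qed

section \<open>Toric sequences\<close>

text \<open>The invariant of toric sequences. The free permutation absorbs the relabellings
  contained in the moves, which bare mutations do not perform.\<close>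

definition reachable :: "seed set" where
  "reachable = {pull \<pi> v | \<pi> u v. \<pi> permutes verts \<and> u \<in> normal_forms \<and> v \<in> {u, mutate 2 u, mutate 4 u}}"

lemma reachableI:
  assumes "\<pi> permutes verts" "u \<in> normal_forms" "v \<in> {u, mutate 2 u, mutate 4 u}"
  shows "pull \<pi> v \<in> reachable"
  using assms unfolding reachable_def by blast

lemma reachable_pull:
  assumes "\<pi> permutes verts" "v \<in> reachable"
  shows "pull \<pi> v \<in> reachable"
proof -
  obtain \<tau> u x where "\<tau> permutes verts" "v = pull \<tau> x"
    and x: "u \<in> normal_forms" "x \<in> {u, mutate 2 u, mutate 4 u}"
    using assms(2) unfolding reachable_def by blast
  then show ?thesis
    using reachableI[OF permutes_compose[OF assms(1)] x] by (simp add: pull_pull)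
qed

lemma reachable_unpull:
  assumes "u \<in> normal_forms" "v \<in> {u, mutate 2 u, mutate 4 u}"
  shows "v \<in> reachable"
  using reachableI[OF permutes_id assms] by (simp add: pull_id)

lemma reachable_mutate_representative:
  assumes u: "u \<in> normal_forms" and v: "v \<in> {u, mutate 2 u, mutate 4 u}"
    and i: "i \<in> verts" "toric (fst v) i"
  shows "mutate i v \<in> reachable"
proof -
  have Q_seed: "Q_seed u" by (rule Q_seed_normal_forms[OF u])
  then obtain y where y: "u = (Q, y)" by (rule Q_seedE)
  \<comment> \<open>Strips the final relabelling from a move by pulling back along the same
    permutation.\<close>
  have unrotate: "x \<in> reachable" if "relabel \<sigma> x \<in> normal_forms" "\<sigma> permutes verts" for x \<sigma>
    using reachableI[OF that(2,1), of "relabel \<sigma> x"] by (simp add: pull_relabel[OF that(2)])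
  have mutations: "mutate 1 u \<in> reachable" "mutate 5 u \<in> reachable"
    "mutate 4 (mutate 2 u) \<in> reachable"
    using unrotate[OF _ rotation_permutes(1), of "mutate 1 u"] rho1_normal_forms[OF u]
      unrotate[OF _ rotation_permutes(2), of "mutate 5 u"] rho2_normal_forms[OF u]
      unrotate[OF _ rotation_permutes(3), of "mutate 4 (mutate 2 u)"] rho3_normal_forms[OF u]
    by (simp_all add: rho_def del: cycle_of_list.simps)
  have representatives: "u \<in> reachable" "mutate 2 u \<in> reachable" "mutate 4 u \<in> reachable"
    by (simp_all add: reachable_unpull[OF u])
  have nf: "rho 1 (rho 1 u) \<in> normal_forms" "rho 2 (rho 2 u) \<in> normal_forms"
    using u by (simp_all only: rho1_normal_forms rho2_normal_forms)
  from v consider "v = u" | "v = mutate 2 u" | "v = mutate 4 u" by blast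
  then show ?thesis
  proof cases
    case 1
    \<comment> \<open>Mutations at 1 and 5 are moves up to rotation; those at 2 and 4 are
      representatives themselves.\<close>
    then have "i \<in> {1, 2, 4, 5}" using i toric_Q y by auto
    then show ?thesis using 1 mutations representatives by auto
  next
    case 2
    then have "i \<in> {1, 2, 4}" using i toric_Q2 y by (simp add: mutate_Q)
    moreover have "mutate 1 (mutate 2 u) \<in> reachable"
      unfolding mutate_1_mutate_2[OF Q_seed] by (rule reachableI[OF relabellings_permute(4) nf(1)]) simp
    ultimately show ?thesis
      using 2 mutations mutate_2_mutate_2[OF Q_seed] representatives by auto
  next
    case 3
    then have "i \<in> {2, 4, 5}" using i toric_Q4 y by (simp add: mutate_Q)
    moreover have "mutate 5 (mutate 4 u) \<in> reachable"
      unfolding mutate_5_mutate_4[OF Q_seed] by (rule reachableI[OF relabellings_permute(5) nf(2)]) simp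
    ultimately show ?thesis
      using 3 mutations mutate_4_mutate_4[OF Q_seed] mutate_2_mutate_4[OF Q_seed] representatives
      by auto
  qed
qed

text \<open>By equivariance, mutating at \<open>i\<close> amounts to mutating the representative at
  \<open>\<pi> i\<close>.\<close>

lemma reachable_mutate:
  assumes "s \<in> reachable" "i \<in> verts" "toric (fst s) i"
  shows "mutate i s \<in> reachable"
proof -
  obtain \<pi> u v where \<pi>: "\<pi> permutes verts" and s: "s = pull \<pi> v"
    and v: "u \<in> normal_forms" "v \<in> {u, mutate 2 u, mutate 4 u}"
    using assms(1) unfolding reachable_def by blast
  have "\<pi> i \<in> verts" using permutes_in_image[OF \<pi>] assms(2) by simp
  moreover have "toric (fst v) (\<pi> i)" using assms(3) unfolding s toric_pull[OF \<pi>] .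
  ultimately show ?thesis
    unfolding s mutate_pull[OF \<pi>]
    by (intro reachable_pull[OF \<pi>] reachable_mutate_representative[OF v])
qed

lemma reachable_toric_sequence:
  "s \<in> reachable \<Longrightarrow> toric_sequence s vs \<Longrightarrow> fold mutate vs s \<in> reachable"
proof (induction vs arbitrary: s)
  case (Cons i vs)
  then show ?case using reachable_mutate[of s i] by simp
qed simp

lemma initial_seed_reachable: "initial_seed \<in> reachable"
proof -
  have "initial_seed \<in> powers" using powersI[of 1 0] by simp
  then have "initial_seed \<in> normal_forms" using normal_formsI(1)[of _ 0] by simp
  then show ?thesis by (rule reachable_unpull) simp
qed

section \<open>Arrow multiplicity as an obstruction to isomorphism\<close>

lemma Q_entry_le_2: "i \<in> verts \<Longrightarrow> j \<in> verts \<Longrightarrow> Q i j \<le> 2"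
  by (auto simp: verts_eq entries)

text \<open>The bound ignores the direction of arrows, so it covers \<open>Q\<close> and its
  opposite alike.\<close>

lemma iso_Q_entry_le_2:
  assumes "quiver_iso a Q \<or> quiver_iso a (opposite Q)" "i \<in> verts" "j \<in> verts"
  shows "a i j \<le> 2"
proof -
  obtain \<sigma> where \<sigma>: "bij_betw \<sigma> verts verts"
    and "Q (\<sigma> i) (\<sigma> j) = a i j \<or> Q (\<sigma> j) (\<sigma> i) = a i j"
    using assms unfolding quiver_iso_def opposite_def by blast
  moreover have "\<sigma> i \<in> verts" "\<sigma> j \<in> verts"
    using assms(2,3) \<sigma> by (auto simp: bij_betw_def)
  ultimately show ?thesis using Q_entry_le_2 by metis
qed

theorem theorem3p3:
  fixes vs :: "nat list" and final :: seed
  assumes "toric_sequence initial_seed vs"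
    and "final = fold mutate vs initial_seed"
    and "quiver_iso (fst final) Q \<or> quiver_iso (fst final) (opposite Q)"
  shows "\<exists>(k::nat) (m::nat). \<exists>t\<in>{1, 2}. \<exists>w\<in>{0, 1}.
           same_cluster (snd final) (snd (rho_word t k m w initial_seed))"
proof -
  have "final \<in> reachable"
    using assms reachable_toric_sequence initial_seed_reachable by simp
  then obtain \<pi> u v where \<pi>: "\<pi> permutes verts" and final: "final = pull \<pi> v"
    and u: "u \<in> normal_forms" and v: "v \<in> {u, mutate 2 u, mutate 4 u}"
    unfolding reachable_def by blast
  obtain y where y: "u = (Q, y)" using Q_seed_normal_forms[OF u] by (rule Q_seedE)
  \<comment> \<open>The hypothesis bounds the arrows of \<open>final\<close>; evaluating at
    preimages under \<pi> carries the bound to \<open>v\<close>.\<close>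
  have small: "fst v i j \<le> 2" if "i \<in> verts" "j \<in> verts" for i j
  proof -
    have "inv \<pi> i \<in> verts" "inv \<pi> j \<in> verts"
      using that permutes_in_image[OF permutes_inv[OF \<pi>]] by simp_all
    from iso_Q_entry_le_2[OF assms(3) this] show ?thesis
      unfolding final by (simp add: pull_def permutes_inverses[OF \<pi>])
  qed
  \<comment> \<open>The pairs (5, 3) here and (3, 1) below carry the triple arrows of
    \<open>Q2\<close> and \<open>Q4\<close>.\<close>
  have "v \<noteq> mutate 2 u"
    using small[of 5 3] by (auto simp: y mutate_Q entries verts_eq)
  moreover have "v \<noteq> mutate 4 u"
    using small[of 3 1] by (auto simp: y mutate_Q entries verts_eq)
  ultimately have "v = u" using v by blast
  moreover obtain t k m w where "t \<in> {1, 2}" "w \<in> {0, 1}" "u = rho_word t k m w initial_seed"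
    using u unfolding normal_forms_eq_rho_words by blast
  moreover have "same_cluster (snd final) (snd v)"
    unfolding same_cluster_def final pull_def using \<pi> by auto
  ultimately show ?thesis by blast
qed

end
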